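(* Every graph $G$ has a unique clique module decomposition.
   Context: All graphs are finite, simple and undirected. A subset $S\subseteq V(G)$ is a module in $G$ if every $v\in V(G)\setminus S$ is either adjacent to all vertices of $S$ or to none of them. If $S$ is also a clique (its vertices are pairwise adjacent), it is called a clique module. A clique module $C$ is maximal if there is no other clique module $C'$ with $C\subset C'$. A clique module decomposition of $G$ is a partition of $V(G)$ into maximal clique modules. *)

theory Defs
  imports "Graph_Theory.Digraph" "HOL-Library.Disjoint_Sets"
begin

text \<open>
  A finite simple undirected graph is an instance of the locale \<^locale>\<open>graph\<close>: a finite,
  symmetric digraph without loops and parallel arcs. Each undirected edge is a pair of opposite
  arcs, so the relation \<open>u \<rightarrow>\<^bsub>G\<^esub> v\<close> is symmetric and irreflexive and expresses adjacency.
  The null graph is included.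
\<close>

definition graph_module :: "('a, 'b) pre_digraph \<Rightarrow> 'a set \<Rightarrow> bool" where
  "graph_module G S \<longleftrightarrow>
     S \<subseteq> verts G \<and>
     (\<forall>v \<in> verts G - S. (\<forall>s \<in> S. v \<rightarrow>\<^bsub>G\<^esub> s) \<or> (\<forall>s \<in> S. \<not> (v \<rightarrow>\<^bsub>G\<^esub> s)))"

definition clique :: "('a, 'b) pre_digraph \<Rightarrow> 'a set \<Rightarrow> bool" where
  "clique G S \<longleftrightarrow>
     S \<subseteq> verts G \<and> (\<forall>u \<in> S. \<forall>v \<in> S. u \<noteq> v \<longrightarrow> u \<rightarrow>\<^bsub>G\<^esub> v)"

definition clique_module :: "('a, 'b) pre_digraph \<Rightarrow> 'a set \<Rightarrow> bool" where
  "clique_module G S \<longleftrightarrow> graph_module G S \<and> clique G S"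

definition maximal_clique_module :: "('a, 'b) pre_digraph \<Rightarrow> 'a set \<Rightarrow> bool" where
  "maximal_clique_module G C \<longleftrightarrow>
     clique_module G C \<and> \<not> (\<exists>C'. clique_module G C' \<and> C \<subset> C')"

text \<open>
  The blocks of a partition are nonempty, so the null graph has exactly the empty partition
  as its decomposition.
\<close>

definition clique_module_decomposition :: "('a, 'b) pre_digraph \<Rightarrow> 'a set set \<Rightarrow> bool" where
  "clique_module_decomposition G P \<longleftrightarrow>
     partition_on (verts G) P \<and> (\<forall>C \<in> P. maximal_clique_module G C)"

end

theory Submission
  imports Defs
begin

text \<open>
  Two clique modules with a common vertex have a clique module as their union: the common vertex
  decides the adjacency of every vertex outside either one. Hence distinct maximal clique modules
  are disjoint. Singletons are clique modules, so the maximal ones cover the finite vertex set,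
  and a partition into some of them must use every nonempty one.
\<close>

lemma clique_module_Un:
  assumes "symmetric G" and A: "clique_module G A" and B: "clique_module G B"
    and x: "x \<in> A" "x \<in> B"
  shows "clique_module G (A \<union> B)"
proof -
  have sub: "A \<subseteq> verts G" "B \<subseteq> verts G"
    using A B by (auto simp: clique_module_def clique_def)
  have adj: "u \<rightarrow>\<^bsub>G\<^esub> v" if "C = A \<or> C = B" "u \<in> C" "v \<in> C" "u \<noteq> v" for u v C
    using that A B by (auto simp: clique_module_def clique_def)
  \<comment> \<open>Since \<open>x\<close> lies in both modules, it serves as one reference vertex
    for \<open>A\<close> and for \<open>B\<close>.\<close>
  have twin: "u \<rightarrow>\<^bsub>G\<^esub> v \<longleftrightarrow> u \<rightarrow>\<^bsub>G\<^esub> x"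
    if "C = A \<or> C = B" "u \<in> verts G - C" "v \<in> C" for u v C
  proof -
    have "graph_module G C" "x \<in> C"
      using that(1) A B x by (auto simp: clique_module_def)
    then have "(\<forall>s \<in> C. u \<rightarrow>\<^bsub>G\<^esub> s) \<or> (\<forall>s \<in> C. \<not> u \<rightarrow>\<^bsub>G\<^esub> s)"
      using that(2) by (simp only: graph_module_def)
    with \<open>x \<in> C\<close> that(3) show ?thesis by auto
  qed
  \<comment> \<open>The clique \<open>B\<close> joins \<open>b\<close> to \<open>x\<close>; as
    \<open>b\<close> is outside the module \<open>A\<close>, this adjacency spreads from
    \<open>x\<close> to all of \<open>A\<close>. Modules only control arcs leaving the outside
    vertex, so the opposite arc comes from symmetry.\<close>
  have cross: "b \<rightarrow>\<^bsub>G\<^esub> a" "a \<rightarrow>\<^bsub>G\<^esub> b" if "a \<in> A" "b \<in> B - A" for a b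
  proof -
    have "b \<rightarrow>\<^bsub>G\<^esub> x" using adj[of B b x] that x by auto
    then show "b \<rightarrow>\<^bsub>G\<^esub> a" using twin[of A b a] that sub by auto
    then show "a \<rightarrow>\<^bsub>G\<^esub> b"
      using \<open>symmetric G\<close> by (auto simp: symmetric_def dest: symD)
  qed
  have "u \<rightarrow>\<^bsub>G\<^esub> v" if "u \<in> A \<union> B" "v \<in> A \<union> B" "u \<noteq> v" for u v
    using that adj[of A u v] adj[of B u v] cross[of u v] cross[of v u] by auto
  then have "clique G (A \<union> B)"
    using sub by (simp add: clique_def)
  \<comment> \<open>A vertex outside the union is outside both sets, and both compare it with the
    same \<open>x\<close>. Whether \<open>u\<close> is adjacent to \<open>x\<close> then decides
    which disjunct of \<open>graph_module\<close> holds.\<close>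
  moreover have "u \<rightarrow>\<^bsub>G\<^esub> v \<longleftrightarrow> u \<rightarrow>\<^bsub>G\<^esub> x"
    if "u \<in> verts G - (A \<union> B)" "v \<in> A \<union> B" for u v
    using that twin[of A u v] twin[of B u v] by auto
  then have "graph_module G (A \<union> B)"
    using sub by (simp add: graph_module_def)
  ultimately show ?thesis by (simp add: clique_module_def)
qed

lemma maximal_clique_modules_eq:
  assumes "symmetric G" "maximal_clique_module G C" "maximal_clique_module G D"
    and "x \<in> C" "x \<in> D"
  shows "C = D"
proof -
  have "clique_module G (C \<union> D)"
    using assms by (intro clique_module_Un[where x = x]) (auto simp: maximal_clique_module_def)
  then have "\<not> C \<subset> C \<union> D" "\<not> D \<subset> C \<union> D"
    using assms(2,3) by (auto simp only: maximal_clique_module_def)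
  then show ?thesis by blast
qed

lemma clique_module_singleton:
  "x \<in> verts G \<Longrightarrow> clique_module G {x}"
  by (auto simp: clique_module_def graph_module_def clique_def)

text \<open>Clique modules are subsets of a finite set, so there are only finitely many, and a
  finite family has an inclusion-maximal member above each of its members.\<close>

lemma clique_module_subset_maximal:
  assumes "finite (verts G)" "clique_module G S"
  obtains C where "maximal_clique_module G C" "S \<subseteq> C"
proof -
  have "{C. clique_module G C} \<subseteq> Pow (verts G)"
    by (auto simp: clique_module_def clique_def)
  then have "finite {C. clique_module G C}"
    using assms(1) by (simp add: finite_subset)
  from finite_has_maximal2[OF this, of S] assms(2) obtain C
    where C: "clique_module G C" "S \<subseteq> C" "\<forall>D. clique_module G D \<longrightarrow> C \<subseteq> D \<longrightarrow> C = D"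
    by auto
  then have "maximal_clique_module G C"
    unfolding maximal_clique_module_def by blast
  then show ?thesis using C(2) by (rule that)
qed

theorem theorem56:
  fixes G :: "('a, 'b) pre_digraph"
  assumes "graph G"
  shows "\<exists>!P. clique_module_decomposition G P"
proof -
  interpret graph G by fact
  have sym: "symmetric G" by (rule sym_arcs)
  \<comment> \<open>The empty set must be excluded for the null graph, where it is itself a maximal
    clique module but cannot be a block.\<close>
  let ?P = "{C. maximal_clique_module G C \<and> C \<noteq> {}}"
  have cover: "\<exists>C \<in> ?P. x \<in> C" if "x \<in> verts G" for x
    using clique_module_subset_maximal[OF finite_verts clique_module_singleton[OF that]]
    by (metis (mono_tags, lifting) empty_iff insert_subset mem_Collect_eq)
  have sub: "C \<subseteq> verts G" if "C \<in> ?P" for C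
    using that by (auto simp: maximal_clique_module_def clique_module_def clique_def)
  have "clique_module_decomposition G ?P"
    unfolding clique_module_decomposition_def
  proof (intro conjI partition_onI)
    show "\<Union>?P = verts G" using cover sub by blast
    show "disjnt C D" if "C \<in> ?P" "D \<in> ?P" "C \<noteq> D" for C D
      using that maximal_clique_modules_eq[OF sym] by (auto simp: disjnt_iff)
  qed auto
  moreover have "Q = ?P" if Q: "clique_module_decomposition G Q" for Q
  proof
    have part: "partition_on (verts G) Q" and max: "\<And>D. D \<in> Q \<Longrightarrow> maximal_clique_module G D"
      using Q by (auto simp: clique_module_decomposition_def)
    show "Q \<subseteq> ?P" using part max by (auto simp: partition_on_def)
    show "?P \<subseteq> Q"
    proof
      fix C assume C: "C \<in> ?P"
      \<comment> \<open>The block of \<open>Q\<close> covering a vertex of \<open>C\<close> is also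
        maximal and meets \<open>C\<close>, so it is \<open>C\<close>.\<close>
      then obtain x where x: "x \<in> C" by blast
      then have "x \<in> \<Union>Q" using sub[OF C] partition_onD1[OF part] by blast
      then obtain D where D: "D \<in> Q" "x \<in> D" by blast
      then have "C = D" using maximal_clique_modules_eq[OF sym _ max] C x by blast
      with D show "C \<in> Q" by simp
    qed
  qed
  ultimately show ?thesis by blast
qed

end
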